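(* Fix $t>0$, $\mu\in\mathbb{R}$ and $\sigma>0$. For $x_0\in\mathbb{R}$ let $\gamma_{x_0}$ denote the Gaussian probability measure on $\mathbb{R}$ with mean $x_0+\mu t$ and variance $\sigma^2 t$. For $n\in\mathbb{N}$ let $T^{**}_n:\mathbb{R}^n\to\mathbb{R}$ be given by $$T^{**}_n((z_k)_{1\le k\le n})=\frac{\sum_{k=1}^n (z_k-t\mu)}{n}.$$ Then the estimators $T_{***}^{(0)}:\mathbb{R}^\infty\to\mathbb{R}$ and $T_{***}^{(1)}:\mathbb{R}^\infty\to\mathbb{R}$ defined by $$T_{***}^{(0)}((z_k)_{k\in\mathbb{N}})=\liminf_{n\to\infty}T^{**}_n((z_k)_{1\le k\le n})$$ and $$T_{***}^{(1)}((z_k)_{k\in\mathbb{N}})=\limsup_{n\to\infty}T^{**}_n((z_k)_{1\le k\le n})$$ are infinite-sample consistent estimators of the initial position $x_0$ for the family of probability measures $(\gamma_{x_0}^{\infty})_{x_0\in\mathbb{R}}$.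
   Context: $\mathbb{N}=\{1,2,\dots\}$, and $\mathbb{R}^{\infty}=\mathbb{R}^{\mathbb{N}}$ is the space of real sequences with its Borel $\sigma$-algebra. For a Borel probability measure $\gamma$ on $\mathbb{R}$, $\gamma^{\infty}$ is the infinite product (power) measure on $\mathbb{R}^{\infty}$. The measure $\gamma_{x_0}$ is the law at time $t$ of the Wiener process with drift $X_t=x_0+\mu t+\sigma W_t$, where $x_0$ is the initial position. Given a family $(\gamma_\theta)_{\theta\in\mathbb{R}}$ of Borel probability measures on $\mathbb{R}$, a Borel measurable function $T:\mathbb{R}^\infty\to\mathbb{R}$ is called an infinite-sample consistent estimator of the parameter $\theta$ for the family $(\gamma_\theta^\infty)_{\theta\in\mathbb{R}}$ if $\gamma_\theta^\infty(\{(x_k)_{k\in\mathbb{N}}\in\mathbb{R}^\infty:T((x_k)_{k\in\mathbb{N}})=\theta\})=1$ for every $\theta\in\mathbb{R}$. *)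

theory Defs
  imports "HOL-Probability.Probability"
begin

text \<open>
  The space of real sequences is the type \<^typ>\<open>nat \<Rightarrow> real\<close>, whose \<^term>\<open>borel\<close> is that of the
  product topology. Sequences are indexed from 0, so \<open>z k\<close> is the mathematical \<open>z\<^sub>k\<^sub>+\<^sub>1\<close>.
\<close>

definition infinite_power :: "real measure \<Rightarrow> (nat \<Rightarrow> real) measure" where
  "infinite_power \<gamma> = Pi\<^sub>M UNIV (\<lambda>_. \<gamma>)"

text \<open>
  The first conjunct is the standing assumption that \<open>\<gamma>\<close> is a family of Borel probability
  measures.
\<close>

definition infinite_sample_consistent_estimator ::
  "(real \<Rightarrow> real measure) \<Rightarrow> ((nat \<Rightarrow> real) \<Rightarrow> real) \<Rightarrow> bool" where
  "infinite_sample_consistent_estimator \<gamma> T \<longleftrightarrow>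
     (\<forall>\<theta>. prob_space (\<gamma> \<theta>) \<and> sets (\<gamma> \<theta>) = sets borel) \<and>
     T \<in> borel_measurable borel \<and>
     (\<forall>\<theta>. emeasure (infinite_power (\<gamma> \<theta>)) {z. T z = \<theta>} = 1)"

text \<open>The second argument of \<^const>\<open>normal_density\<close> is the standard deviation.\<close>

definition drift_law :: "real \<Rightarrow> real \<Rightarrow> real \<Rightarrow> real \<Rightarrow> real measure" where
  "drift_law t \<mu> \<sigma> x\<^sub>0 = density lborel (normal_density (x\<^sub>0 + \<mu> * t) (sqrt (\<sigma>\<^sup>2 * t)))"

text \<open>
  A function of the first \<open>n\<close> coordinates only. The junk value at \<open>n = 0\<close> does not affect
  the limits inferior and superior below.
\<close>

definition initial_position_mean :: "real \<Rightarrow> real \<Rightarrow> nat \<Rightarrow> (nat \<Rightarrow> real) \<Rightarrow> real" where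
  "initial_position_mean t \<mu> n z = (\<Sum>k<n. (z k - t * \<mu>)) / real n"

text \<open>
  The limits inferior and superior may be infinite, while the estimators are real-valued.
  At the sequences where this happens the estimators take a prescribed value \<open>c\<close>.
\<close>

definition real_or :: "real \<Rightarrow> ereal \<Rightarrow> real" where
  "real_or c e = (if \<bar>e\<bar> = \<infinity> then c else real_of_ereal e)"

definition liminf_estimator :: "real \<Rightarrow> real \<Rightarrow> real \<Rightarrow> (nat \<Rightarrow> real) \<Rightarrow> real" where
  "liminf_estimator c t \<mu> z = real_or c (liminf (\<lambda>n. ereal (initial_position_mean t \<mu> n z)))"

definition limsup_estimator :: "real \<Rightarrow> real \<Rightarrow> real \<Rightarrow> (nat \<Rightarrow> real) \<Rightarrow> real" where
  "limsup_estimator c t \<mu> z = real_or c (limsup (\<lambda>n. ereal (initial_position_mean t \<mu> n z)))"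

end

theory Submission
  imports Defs
begin

text \<open>
  Under \<open>\<gamma>\<^sup>\<infinity>\<close> the mean of the first \<open>n\<close> observations is Gaussian with variance \<open>\<sigma>\<^sup>2 t / n\<close>, so its
  fourth central moment is \<open>3 (\<sigma>\<^sup>2 t)\<^sup>2 / n\<^sup>2\<close>. These moments are summable, hence the fourth powers
  of the deviations are almost surely summable, and the means converge almost surely. The limits
  inferior and superior both agree with the limit wherever it exists.
\<close>

text \<open>Sum and integral commute for nonnegative terms, so the series of the
  \<open>f n x ^ p\<close> has finite integral and is finite almost everywhere. The terms of a
  convergent series tend to 0. Evenness of \<open>p\<close> makes the powers nonnegative, so
  \<open>ennreal\<close> truncates nothing.\<close>

lemma AE_tendsto_zero_of_summable_moments:
  fixes f :: "nat \<Rightarrow> 'a \<Rightarrow> real"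
  assumes [measurable]: "\<And>n. f n \<in> borel_measurable M"
    and moment: "\<And>n. (\<integral>\<^sup>+x. ennreal (f n x ^ p) \<partial>M) \<le> ennreal (b n)"
    and "even p" "p > 0" "summable b" "\<And>n. b n \<ge> 0"
  shows "AE x in M. (\<lambda>n. f n x) \<longlonglongrightarrow> 0"
proof -
  have "(\<integral>\<^sup>+x. (\<Sum>n. ennreal (f n x ^ p)) \<partial>M) = (\<Sum>n. \<integral>\<^sup>+x. ennreal (f n x ^ p) \<partial>M)"
    by (rule nn_integral_suminf) simp
  also have "\<dots> \<le> (\<Sum>n. ennreal (b n))"
    by (intro suminf_le moment) auto
  also have "\<dots> < \<infinity>"
    using ennreal_suminf_neq_top[OF assms(5,6)] by (simp add: less_top)
  finally have "AE x in M. (\<Sum>n. ennreal (f n x ^ p)) \<noteq> \<infinity>"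
    by (intro nn_integral_PInf_AE) auto
  then show ?thesis
  proof (eventually_elim)
    case (elim x)
    have "summable (\<lambda>n. f n x ^ p)"
      using elim \<open>even p\<close> by (intro summable_suminf_not_top) (auto simp: zero_le_even_power)
    then have "(\<lambda>n. f n x ^ p) \<longlonglongrightarrow> 0"
      by (rule summable_LIMSEQ_zero)
    then have "(\<lambda>n. root p (f n x ^ p)) \<longlonglongrightarrow> root p 0"
      by (rule tendsto_real_root)
    \<comment> \<open>An even power forgets the sign; the absolute value suffices because the limit
      is 0.\<close>
    moreover have "root p (f n x ^ p) = \<bar>f n x\<bar>" for n
      using real_root_power_cancel[of p "\<bar>f n x\<bar>"] \<open>even p\<close> \<open>p > 0\<close> by (simp add: power_even_abs)
    ultimately have "(\<lambda>n. \<bar>f n x\<bar>) \<longlonglongrightarrow> 0"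
      by simp
    then show ?case
      by (rule tendsto_rabs_zero_cancel)
  qed
qed

lemma (in prob_space) nn_integral_normal_fourth_moment:
  assumes "distributed M lborel X (normal_density m s)" "s > 0"
  shows "(\<integral>\<^sup>+x. ennreal ((X x - m) ^ 4) \<partial>M) = ennreal (3 * s ^ 4)"
proof -
  have "(\<integral>\<^sup>+x. ennreal ((X x - m) ^ 4) \<partial>M)
      = (\<integral>\<^sup>+x. ennreal (normal_density m s x) * ennreal ((x - m) ^ 4) \<partial>lborel)"
    by (rule distributed_nn_integral[OF assms(1), symmetric]) simp
  also have "\<dots> = (\<integral>\<^sup>+x. ennreal (normal_density m s x * (x - m) ^ 4) \<partial>lborel)"
    by (simp add: ennreal_mult)
  also have "\<dots> = ennreal (\<integral>x. normal_density m s x * (x - m) ^ 4 \<partial>lborel)"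
    using integrable_normal_moment[OF assms(2)] by (intro nn_integral_eq_integral) auto
  \<comment> \<open>The moment of order 2k is (2k)! / ((2 / s^2)^k k!), which for k = 2 equals 24
    s^4 / 8.\<close>
  also have "(\<integral>x. normal_density m s x * (x - m) ^ 4 \<partial>lborel) = 3 * s ^ 4"
    using integral_normal_moment_even[OF assms(2), of m 2] assms(2)
    by (simp add: fact_numeral field_simps)
  finally show ?thesis .
qed

text \<open>The strong law of large numbers for normal variables. The order 4 is chosen because the
  second moments s^2 / n of the deviations are not summable, while the fourth ones decay like 1 /
  n^2.\<close>

lemma (in prob_space) AE_normal_mean_tendsto:
  assumes indep: "indep_vars (\<lambda>_. borel) X (UNIV :: nat set)"
    and X: "\<And>i. distributed M lborel (X i) (normal_density m s)" and "s > 0"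
  shows "AE x in M. (\<lambda>n. (\<Sum>k<n. X k x) / real n) \<longlonglongrightarrow> m"
proof -
  define f where "f n x = ((\<Sum>k<n. X k x) - real n * m) / real n" for n x
  have [measurable]: "random_variable borel (X i)" for i
    using distributed_measurable[OF X[of i]] by simp
  have "AE x in M. (\<lambda>n. f n x) \<longlonglongrightarrow> 0"
  proof (rule AE_tendsto_zero_of_summable_moments[where p = 4])
    show "f n \<in> borel_measurable M" for n
      unfolding f_def by measurable
    show "summable (\<lambda>n. 3 * s ^ 4 / real n ^ 2)"
      using summable_mult[OF inverse_power_summable[of 2, where 'a = real], of "3 * s ^ 4"]
      by (simp add: divide_inverse)
    show "(\<integral>\<^sup>+x. ennreal (f n x ^ 4) \<partial>M) \<le> ennreal (3 * s ^ 4 / real n ^ 2)" for n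
    \<comment> \<open>\<open>sum_indep_normal\<close> requires a nonempty index set. At n = 0
      division by zero makes \<open>f n x\<close> vanish.\<close>
    proof (cases "n = 0")
      case False
      then have n: "real n > 0" by simp
      have "distributed M lborel (\<lambda>x. \<Sum>k<n. X k x)
          (normal_density (\<Sum>k<n. m) (sqrt (\<Sum>k<n. s\<^sup>2)))"
        using False \<open>s > 0\<close> X
        by (intro sum_indep_normal indep_vars_subset[OF indep]) auto
      then have "distributed M lborel (\<lambda>x. \<Sum>k<n. X k x)
          (normal_density (real n * m) (sqrt (real n * s\<^sup>2)))"
        by simp
      then have *: "(\<integral>\<^sup>+x. ennreal (((\<Sum>k<n. X k x) - real n * m) ^ 4) \<partial>M)
          = ennreal (3 * sqrt (real n * s\<^sup>2) ^ 4)"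
        by (rule nn_integral_normal_fourth_moment) (use n \<open>s > 0\<close> in simp)
      have "(\<integral>\<^sup>+x. ennreal (f n x ^ 4) \<partial>M)
          = (\<integral>\<^sup>+x. ennreal (1 / real n ^ 4) * ennreal (((\<Sum>k<n. X k x) - real n * m) ^ 4) \<partial>M)"
        by (simp add: f_def power_divide flip: ennreal_mult')
      also have "\<dots> = ennreal (1 / real n ^ 4) * ennreal (3 * sqrt (real n * s\<^sup>2) ^ 4)"
        unfolding *[symmetric] by (rule nn_integral_cmult) simp
      also have "\<dots> = ennreal (1 / real n ^ 4 * (3 * sqrt (real n * s\<^sup>2) ^ 4))"
        by (rule ennreal_mult'[symmetric]) simp
      also have "sqrt (real n * s\<^sup>2) ^ 4 = (sqrt (real n * s\<^sup>2) ^ 2) ^ 2"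
        by (metis power_even_eq mult_2_right numeral_Bit0 one_add_one)
      also have "\<dots> = (real n * s\<^sup>2) ^ 2"
        by simp
      also have "1 / real n ^ 4 * (3 * (real n * s\<^sup>2) ^ 2) = 3 * s ^ 4 / real n ^ 2"
        using n by (simp add: power2_eq_square power4_eq_xxxx)
      finally show ?thesis by simp
    qed (simp add: f_def)
  qed (use \<open>s > 0\<close> in auto)
  then show ?thesis
  proof eventually_elim
    case (elim x)
    have "(\<lambda>n. f n x + m) \<longlonglongrightarrow> m"
      using tendsto_add[OF elim tendsto_const[of m]] by simp
    \<comment> \<open>Only eventually: at n = 0 the left side is \<open>m\<close> and the right side
      is 0.\<close>
    moreover have "\<forall>\<^sub>F n in sequentially. f n x + m = (\<Sum>k<n. X k x) / real n"
      using eventually_gt_at_top[of 0] by eventually_elim (simp add: f_def field_simps)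
    ultimately show ?case
      by (rule Lim_transform_eventually)
  qed
qed

text \<open>Independence means that the joint law is the product of the marginals. Points of the
  product space are extensional, so the joint map of the coordinates is the identity there and its
  law is the product measure itself; the marginals are the factors.\<close>

lemma indep_vars_PiM_coordinates:
  assumes "\<And>i. i \<in> I \<Longrightarrow> prob_space (M i)" "I \<noteq> {}"
  shows "prob_space.indep_vars (Pi\<^sub>M I M) M (\<lambda>i x. x i) I"
proof -
  interpret prob_space "Pi\<^sub>M I M"
    using assms(1) by (rule prob_space_PiM)
  have "distr (Pi\<^sub>M I M) (Pi\<^sub>M I M) (\<lambda>x. \<lambda>i\<in>I. x i) = distr (Pi\<^sub>M I M) (Pi\<^sub>M I M) (\<lambda>x. x)"
    by (rule distr_cong) (auto simp: space_PiM)
  moreover have "(\<Pi>\<^sub>M i\<in>I. distr (Pi\<^sub>M I M) (M i) (\<lambda>x. x i)) = Pi\<^sub>M I M"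
    using assms(1) by (intro PiM_cong distr_PiM_component) auto
  ultimately show ?thesis
    using assms(2) by (subst indep_vars_iff_distr_eq_PiM') auto
qed

lemma AE_infinite_power_normal_mean_tendsto:
  fixes m s a :: real
  assumes "s > 0"
  defines "\<gamma> \<equiv> density lborel (normal_density m s)"
  shows "AE z in infinite_power \<gamma>. (\<lambda>n. (\<Sum>k<n. z k - a) / real n) \<longlonglongrightarrow> m - a"
proof -
  have \<gamma>: "prob_space \<gamma>"
    unfolding \<gamma>_def by (rule prob_space_normal_density) fact
  interpret prob_space "infinite_power \<gamma>"
    unfolding infinite_power_def using \<gamma> by (rule prob_space_PiM)
  have "indep_vars (\<lambda>_. \<gamma>) (\<lambda>i z. z i) (UNIV :: nat set)"
    unfolding infinite_power_def using \<gamma> by (intro indep_vars_PiM_coordinates) auto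
  then have indep: "indep_vars (\<lambda>_. borel) (\<lambda>i z. z i) (UNIV :: nat set)"
    by (rule indep_vars_compose2[where Y = "\<lambda>_ x. x"]) (simp add: \<gamma>_def)
  \<comment> \<open>\<open>distributed\<close> takes the law over \<open>lborel\<close>, the
    component law is stated over \<gamma>. Both have the Borel sets, and \<open>distr\<close>
    depends on its target only through space and sets.\<close>
  have "distr (infinite_power \<gamma>) lborel (\<lambda>z. z i) = \<gamma>" for i
  proof -
    have "distr (infinite_power \<gamma>) lborel (\<lambda>z. z i) = distr (infinite_power \<gamma>) \<gamma> (\<lambda>z. z i)"
      by (rule distr_cong) (auto simp: \<gamma>_def)
    also have "\<dots> = \<gamma>"
      unfolding infinite_power_def using \<gamma> by (intro distr_PiM_component) auto
    finally show ?thesis .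
  qed
  moreover have "random_variable borel (\<lambda>z. z i)" for i
    using indep by (simp add: indep_vars_def)
  ultimately have "distributed (infinite_power \<gamma>) lborel (\<lambda>z. z i) (normal_density m s)" for i
    unfolding distributed_def by (simp add: \<gamma>_def)
  from AE_normal_mean_tendsto[OF indep this \<open>s > 0\<close>] show ?thesis
  proof eventually_elim
    case (elim z)
    have "(\<lambda>n. (\<Sum>k<n. z k) / real n - a) \<longlonglongrightarrow> m - a"
      using elim by (intro tendsto_diff) auto
    moreover have "\<forall>\<^sub>F n in sequentially.
        (\<Sum>k<n. z k) / real n - a = (\<Sum>k<n. z k - a) / real n"
      using eventually_gt_at_top[of 0]
      by eventually_elim (simp add: sum_subtractf field_simps)
    ultimately show ?case
      by (rule Lim_transform_eventually)
  qed
qed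

text \<open>Subtracting \<open>t * \<mu>\<close> from each observation cancels the drift in the mean
  \<open>x + \<mu> * t\<close>.\<close>

lemma AE_initial_position_mean_tendsto:
  assumes "t > 0" "\<sigma> > 0"
  shows "AE z in infinite_power (drift_law t \<mu> \<sigma> x).
    (\<lambda>n. initial_position_mean t \<mu> n z) \<longlonglongrightarrow> x"
  using AE_infinite_power_normal_mean_tendsto
    [where s = "sqrt (\<sigma>\<^sup>2 * t)" and m = "x + \<mu> * t" and a = "t * \<mu>"] assms
  unfolding drift_law_def initial_position_mean_def by (simp add: mult.commute)

text \<open>For countably many real factors the product \<sigma>-algebra is the Borel one of the
  product topology. This links measurability of an estimator to the power measure.\<close>

lemma sets_infinite_power:
  assumes "sets \<gamma> = sets borel"
  shows "sets (infinite_power \<gamma>) = sets borel"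
  unfolding infinite_power_def using sets_PiM_cong[OF refl assms] sets_PiM_equal_borel by blast

lemma infinite_sample_consistent_estimatorI:
  assumes "\<And>\<theta>. prob_space (\<gamma> \<theta>)" and "\<And>\<theta>. sets (\<gamma> \<theta>) = sets borel"
    and [measurable]: "T \<in> borel_measurable borel"
    and AE: "\<And>\<theta>. AE z in infinite_power (\<gamma> \<theta>). T z = \<theta>"
  shows "infinite_sample_consistent_estimator \<gamma> T"
proof -
  have "emeasure (infinite_power (\<gamma> \<theta>)) {z. T z = \<theta>} = 1" for \<theta>
  proof -
    interpret prob_space "infinite_power (\<gamma> \<theta>)"
      unfolding infinite_power_def using assms(1) by (rule prob_space_PiM)
    have sets: "sets (infinite_power (\<gamma> \<theta>)) = sets borel"
      using assms(2) by (rule sets_infinite_power)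
    have "{z. T z = \<theta>} \<in> sets (infinite_power (\<gamma> \<theta>))"
      unfolding sets by measurable
    then show ?thesis
      using AE[of \<theta>] by (intro emeasure_eq_1_AE) auto
  qed
  then show ?thesis
    using assms(1-3) unfolding infinite_sample_consistent_estimator_def by blast
qed

lemma borel_measurable_initial_position_mean [measurable]:
  "initial_position_mean t \<mu> n \<in> borel_measurable borel"
  \<comment> \<open>The mean is continuous in finitely many coordinates. Multiplying by a constant
    inverse avoids the nonzero denominator that continuity of division demands, which fails at n =
    0.\<close>
  unfolding initial_position_mean_def divide_inverse
  by (intro borel_measurable_continuous_onI continuous_intros) auto

lemma borel_measurable_real_or [measurable]: "real_or c \<in> borel_measurable borel"
  unfolding real_or_def by measurable

lemma borel_measurable_liminf_estimator: "liminf_estimator c t \<mu> \<in> borel_measurable borel"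
  unfolding liminf_estimator_def by measurable

lemma borel_measurable_limsup_estimator: "limsup_estimator c t \<mu> \<in> borel_measurable borel"
  unfolding limsup_estimator_def by measurable

text \<open>A real limit is a finite value of both the limit inferior and the limit superior, so
  \<open>real_or\<close> returns it rather than the default \<open>c\<close>.\<close>

lemma estimators_eq_limit:
  assumes "(\<lambda>n. initial_position_mean t \<mu> n z) \<longlonglongrightarrow> x"
  shows "liminf_estimator c t \<mu> z = x" "limsup_estimator c t \<mu> z = x"
proof -
  have "(\<lambda>n. ereal (initial_position_mean t \<mu> n z)) \<longlonglongrightarrow> ereal x"
    using assms by simp
  from lim_imp_Liminf[OF _ this] lim_imp_Limsup[OF _ this]
  show "liminf_estimator c t \<mu> z = x" "limsup_estimator c t \<mu> z = x"
    unfolding liminf_estimator_def limsup_estimator_def by (simp_all add: real_or_def)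
qed

theorem theorem3p3p2:
  fixes t \<mu> \<sigma> c :: real
  assumes "t > 0" and "\<sigma> > 0"
  shows "infinite_sample_consistent_estimator (\<lambda>x\<^sub>0. drift_law t \<mu> \<sigma> x\<^sub>0) (liminf_estimator c t \<mu>)
       \<and> infinite_sample_consistent_estimator (\<lambda>x\<^sub>0. drift_law t \<mu> \<sigma> x\<^sub>0) (limsup_estimator c t \<mu>)"
proof -
  have prob: "prob_space (drift_law t \<mu> \<sigma> x)" for x
    unfolding drift_law_def using assms by (intro prob_space_normal_density) simp
  have sets: "sets (drift_law t \<mu> \<sigma> x) = sets borel" for x
    by (simp add: drift_law_def)
  have "AE z in infinite_power (drift_law t \<mu> \<sigma> x). liminf_estimator c t \<mu> z = x"
    "AE z in infinite_power (drift_law t \<mu> \<sigma> x). limsup_estimator c t \<mu> z = x" for x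
    by (rule eventually_mono[OF AE_initial_position_mean_tendsto[OF assms]],
        erule estimators_eq_limit)+
  then show ?thesis
    by (intro conjI infinite_sample_consistent_estimatorI prob sets
        borel_measurable_liminf_estimator borel_measurable_limsup_estimator)
qed

end
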